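(* Let $\eta$ be a continuous and free partial action of a profinite group $G$ on a profinite space $X$ such that $G*X$ is clopen in $G\times X$. Then the quotient map $\pi_G: X\to X/\!\sim_G$ has a continuous section, i.e. there is a continuous map $s:X/\!\sim_G\to X$ with $\pi_G\circ s=\mathrm{id}_{X/\sim_G}$.
   Context: A topological space is profinite if it is homeomorphic to an inverse limit of finite discrete spaces; equivalently, it is compact, Hausdorff and zero-dimensional. A topological group is profinite if it is profinite as a topological space. A partial action $\eta$ of a group $G$ (with identity $1$) on a set $X$ is a partially defined map $G\times X\to X$, $(g,x)\mapsto g\cdot x$ (write $\exists g\cdot x$ when $g\cdot x$ is defined), such that for all $g,h\in G$, $x\in X$: (PA1) if $\exists g\cdot x$, then $\exists g^{-1}\cdot(g\cdot x)$ and $g^{-1}\cdot(g\cdot x)=x$; (PA2) if $\exists g\cdot(h\cdot x)$, then $\exists (gh)\cdot x$ and $g\cdot(h\cdot x)=(gh)\cdot x$; (PA3) $\exists 1\cdot x$ and $1\cdot x=x$. Put $G*X=\{(g,x)\in G\times X: \exists g\cdot x\}$ (the domain of $\eta$), $X_g=\{x\in X:\exists g^{-1}\cdot x\}$, and $\eta_g:X_{g^{-1}}\to X_g$, $x\mapsto g\cdot x$ (a bijection). When $G$ is a topological group and $X$ a topological space, $G\times X$ has the product topology and $G*X$ the subspace topology; $\eta$ is topological if every $X_g$ is open in $X$ and every $\eta_g$ is a homeomorphism; $\eta$ is a continuous partial action if it is topological and $\eta:G*X\to X$ is continuous. The partial action $\eta$ is free if for each $(g,x)\in G*X$ with $g\cdot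 x=x$ one has $g=1$. The orbit equivalence relation $\sim_G$ on $X$ is: $x\sim_G y$ if and only if there is $g\in G$ with $\exists g\cdot x$ and $g\cdot x=y$. The orbit space $X/\!\sim_G$ has the quotient topology, and $\pi_G$ sends $x$ to its orbit. *)

theory Defs
  imports "HOL-Analysis.Analysis" "HOL-Algebra.Group"
begin

section \<open>Profinite spaces and groups\<close>

definition directed_set :: "'i set \<Rightarrow> ('i \<Rightarrow> 'i \<Rightarrow> bool) \<Rightarrow> bool" where
  "directed_set I leq \<longleftrightarrow>
     I \<noteq> {} \<and>
     (\<forall>i\<in>I. leq i i) \<and>
     (\<forall>i\<in>I. \<forall>j\<in>I. \<forall>k\<in>I. leq i j \<longrightarrow> leq j k \<longrightarrow> leq i k) \<and>
     (\<forall>i\<in>I. \<forall>j\<in>I. \<exists>k\<in>I. leq i k \<and> leq j k)"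

definition inverse_system ::
    "'i set \<Rightarrow> ('i \<Rightarrow> 'i \<Rightarrow> bool) \<Rightarrow> ('i \<Rightarrow> 'b topology) \<Rightarrow> ('i \<Rightarrow> 'i \<Rightarrow> 'b \<Rightarrow> 'b) \<Rightarrow> bool" where
  "inverse_system I leq T f \<longleftrightarrow>
     directed_set I leq \<and>
     (\<forall>i\<in>I. \<forall>j\<in>I. leq i j \<longrightarrow> continuous_map (T j) (T i) (f i j)) \<and>
     (\<forall>i\<in>I. \<forall>x\<in>topspace (T i). f i i x = x) \<and>
     (\<forall>i\<in>I. \<forall>j\<in>I. \<forall>k\<in>I. leq i j \<longrightarrow> leq j k \<longrightarrow>
        (\<forall>x\<in>topspace (T k). f i j (f j k x) = f i k x))"

definition inverse_limit ::
    "'i set \<Rightarrow> ('i \<Rightarrow> 'i \<Rightarrow> bool) \<Rightarrow> ('i \<Rightarrow> 'b topology) \<Rightarrow> ('i \<Rightarrow> 'i \<Rightarrow> 'b \<Rightarrow> 'b) \<Rightarrow> ('i \<Rightarrow> 'b) topology"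
  where
  "inverse_limit I leq T f =
     subtopology (product_topology T I) {x. \<forall>i\<in>I. \<forall>j\<in>I. leq i j \<longrightarrow> f i j (x j) = x i}"

text \<open>The index set and the finite spaces have to live in fixed types. The types chosen here are
  large enough for the system of all finite clopen partitions of \<open>X\<close>, so nothing is lost:
  \<open>inverse_limit_finite_discrete\<close> and \<open>profinite_space_iff\<close> below show that limits of systems over
  arbitrary types are profinite in this sense.\<close>

definition profinite_space :: "'a topology \<Rightarrow> bool" where
  "profinite_space X \<longleftrightarrow>
     (\<exists>(I :: 'a set set set) leq (S :: 'a set set \<Rightarrow> 'a set set) f.
        (\<forall>i\<in>I. finite (S i)) \<and>
        inverse_system I leq (\<lambda>i. discrete_topology (S i)) f \<and>
        X homeomorphic_space inverse_limit I leq (\<lambda>i. discrete_topology (S i)) f)"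

definition zero_dimensional_space :: "'a topology \<Rightarrow> bool" where
  "zero_dimensional_space X \<longleftrightarrow> neighbourhood_base_of (\<lambda>U. openin X U \<and> closedin X U) X"

lemma zero_dimensional_space_alt:
  "zero_dimensional_space X \<longleftrightarrow>
     (\<forall>W x. openin X W \<and> x \<in> W \<longrightarrow> (\<exists>U. openin X U \<and> closedin X U \<and> x \<in> U \<and> U \<subseteq> W))"
  unfolding zero_dimensional_space_def neighbourhood_base_of
  by (meson order_trans subsetD subset_refl)

lemma zero_dimensional_homeomorphic:
  assumes "X homeomorphic_space Y" "zero_dimensional_space Y"
  shows "zero_dimensional_space X"
proof -
  obtain f g where fg: "homeomorphic_maps X Y f g"
    using assms(1) homeomorphic_space_def by blast
  then have cf: "continuous_map X Y f" and cg: "continuous_map Y X g"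
    and gf: "\<And>x. x \<in> topspace X \<Longrightarrow> g (f x) = x"
    by (auto simp: homeomorphic_maps_def)
  show ?thesis
    unfolding zero_dimensional_space_alt
  proof (intro allI impI)
    fix W x assume W: "openin X W \<and> x \<in> W"
    then have xX: "x \<in> topspace X" using openin_subset by blast
    let ?W = "{y \<in> topspace Y. g y \<in> W}"
    have "openin Y ?W" using cg W openin_continuous_map_preimage by blast
    moreover have "f x \<in> ?W"
      using xX W gf cf by (auto simp: continuous_map_def Pi_iff)
    ultimately obtain U where U: "openin Y U" "closedin Y U" "f x \<in> U" "U \<subseteq> ?W"
      using assms(2) unfolding zero_dimensional_space_alt by meson
    let ?U = "{z \<in> topspace X. f z \<in> U}"
    have "openin X ?U" "closedin X ?U" "x \<in> ?U"
      using U cf xX openin_continuous_map_preimage closedin_continuous_map_preimage by blast+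
    moreover have "?U \<subseteq> W" using U gf by force
    ultimately show "\<exists>U. openin X U \<and> closedin X U \<and> x \<in> U \<and> U \<subseteq> W" by blast
  qed
qed

lemma inverse_limit_finite_discrete:
  assumes fin: "\<And>i. i \<in> I \<Longrightarrow> finite (S i)"
    and sys: "inverse_system I leq (\<lambda>i. discrete_topology (S i)) f"
    and hom: "X homeomorphic_space inverse_limit I leq (\<lambda>i. discrete_topology (S i)) f"
  shows "compact_space X \<and> Hausdorff_space X \<and> zero_dimensional_space X"
proof -
  let ?P = "product_topology (\<lambda>i. discrete_topology (S i)) I"
  let ?L = "inverse_limit I leq (\<lambda>i. discrete_topology (S i)) f"
  define E where "E = (\<lambda>i j. {x \<in> topspace ?P. f i j (x j) = x i})"
  have top: "topspace ?P = Pi\<^sub>E I S" by simp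
  have preim: "openin ?P {x \<in> topspace ?P. x i \<in> A} \<and> closedin ?P {x \<in> topspace ?P. x i \<in> A}"
    if "i \<in> I" for i A
  proof -
    have c: "continuous_map ?P (discrete_topology (S i)) (\<lambda>x. x i)"
      using that by (rule continuous_map_product_projection)
    have eq: "{x \<in> topspace ?P. x i \<in> A} = {x \<in> topspace ?P. x i \<in> A \<inter> S i}"
      using that by auto
    have "openin (discrete_topology (S i)) (A \<inter> S i)" "closedin (discrete_topology (S i)) (A \<inter> S i)"
      by auto
    then show ?thesis
      unfolding eq using openin_continuous_map_preimage[OF c] closedin_continuous_map_preimage[OF c]
      by blast
  qed
  have clE: "closedin ?P (E i j)" if ij: "i \<in> I" "j \<in> I" for i j
  proof -
    have "E i j = (\<Union>b\<in>S j. {x \<in> topspace ?P. x j \<in> {b}} \<inter> {x \<in> topspace ?P. x i \<in> {f i j b}})"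
      using ij by (auto simp: E_def)
    also have "closedin ?P \<dots>"
    proof (rule closedin_Union)
      fix Z assume "Z \<in> (\<lambda>b. {x \<in> topspace ?P. x j \<in> {b}} \<inter> {x \<in> topspace ?P. x i \<in> {f i j b}}) ` S j"
      then obtain b where Z: "Z = {x \<in> topspace ?P. x j \<in> {b}} \<inter> {x \<in> topspace ?P. x i \<in> {f i j b}}"
        by blast
      show "closedin ?P Z"
        unfolding Z by (intro closedin_Int conjunct2[OF preim] ij)
    qed (use fin[OF ij(2)] in simp)
    finally show ?thesis .
  qed
  obtain i0 where i0: "i0 \<in> I" and refl0: "leq i0 i0"
    using sys unfolding inverse_system_def directed_set_def by blast
  let ?K = "{(i, j). i \<in> I \<and> j \<in> I \<and> leq i j}"
  let ?C = "\<Inter>(i, j) \<in> ?K. E i j"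
  have ne: "?K \<noteq> {}" using i0 refl0 by blast
  have clC: "closedin ?P ?C"
    using ne clE by (intro closedin_Inter) auto
  have Leq: "?L = subtopology ?P ?C"
  proof -
    have "topspace ?P \<inter> {x. \<forall>i\<in>I. \<forall>j\<in>I. leq i j \<longrightarrow> f i j (x j) = x i} = topspace ?P \<inter> ?C"
      using i0 refl0 unfolding E_def by blast
    from arg_cong[OF this, of "subtopology ?P"] show ?thesis
      unfolding inverse_limit_def subtopology_restrict .
  qed
  have compP: "compact_space ?P"
    using fin by (simp add: compact_space_product_topology compact_space_discrete_topology)
  have "compact_space ?L"
    unfolding Leq using closedin_compact_space[OF compP clC] compact_space_subtopology by blast
  moreover have "Hausdorff_space ?L"
    unfolding Leq
    by (simp add: Hausdorff_space_subtopology Hausdorff_space_product_topology)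
  moreover have "zero_dimensional_space ?L"
    unfolding zero_dimensional_space_alt
  proof (intro allI impI)
    fix W x assume W: "openin ?L W \<and> x \<in> W"
    then obtain W' where W': "openin ?P W'" "W = W' \<inter> ?C"
      unfolding Leq openin_subtopology by blast
    then have "x \<in> W'" "x \<in> ?C" using W by auto
    then obtain U where U: "finite {i \<in> I. U i \<noteq> S i}"
        "x \<in> Pi\<^sub>E I U" "Pi\<^sub>E I U \<subseteq> W'"
      using W'(1) unfolding openin_product_topology_alt by force
    let ?F = "{i \<in> I. U i \<noteq> S i}"
    let ?V = "topspace ?P \<inter> (\<Inter>i\<in>?F. {x \<in> topspace ?P. x i \<in> U i})"
    have xP: "x \<in> topspace ?P" using \<open>x \<in> W'\<close> W'(1) openin_subset by blast
    have oV: "openin ?P ?V"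
    proof (cases "?F = {}")
      case True then show ?thesis by (metis INT_empty Int_UNIV_right openin_topspace)
    next
      case False
      then have "openin ?P (\<Inter>i\<in>?F. {x \<in> topspace ?P. x i \<in> U i})"
        using U(1) preim by (intro openin_Inter) auto
      then show ?thesis by blast
    qed
    have cV: "closedin ?P ?V"
    proof (cases "?F = {}")
      case True then show ?thesis by (metis INT_empty Int_UNIV_right closedin_topspace)
    next
      case False
      then have "closedin ?P (\<Inter>i\<in>?F. {x \<in> topspace ?P. x i \<in> U i})"
        using preim by (intro closedin_Inter) auto
      then show ?thesis by blast
    qed
    have "x \<in> ?V" using xP U(2) by auto
    have VU: "?V \<subseteq> Pi\<^sub>E I U"
    proof
      fix y assume y: "y \<in> ?V"
      then have yP: "y \<in> Pi\<^sub>E I S" by auto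
      show "y \<in> Pi\<^sub>E I U"
      proof (rule PiE_I)
        fix i assume "i \<in> I"
        then show "y i \<in> U i" using y yP by (cases "U i = S i") auto
      qed (use yP in auto)
    qed
    have "openin ?L (?V \<inter> ?C)"
      unfolding Leq openin_subtopology by (intro exI[of _ ?V] conjI refl oV)
    moreover have "closedin ?L (?V \<inter> ?C)"
      unfolding Leq closedin_subtopology by (intro exI[of _ ?V] conjI refl cV)
    moreover have "x \<in> ?V \<inter> ?C" using \<open>x \<in> ?V\<close> \<open>x \<in> ?C\<close> by blast
    moreover have "?V \<inter> ?C \<subseteq> W"
      unfolding W'(2) by (rule Int_mono[OF subset_trans[OF VU U(3)] order_refl])
    ultimately show "\<exists>U. openin ?L U \<and> closedin ?L U \<and> x \<in> U \<and> U \<subseteq> W"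
      by (intro exI[of _ "?V \<inter> ?C"] conjI)
  qed
  ultimately show ?thesis
    using hom zero_dimensional_homeomorphic homeomorphic_compact_space homeomorphic_Hausdorff_space
    by blast
qed

lemma profinite_space_iff:
  "profinite_space X \<longleftrightarrow> compact_space X \<and> Hausdorff_space X \<and> zero_dimensional_space X"
proof
  assume "profinite_space X"
  then show "compact_space X \<and> Hausdorff_space X \<and> zero_dimensional_space X"
    unfolding profinite_space_def using inverse_limit_finite_discrete by metis
next
  assume asm: "compact_space X \<and> Hausdorff_space X \<and> zero_dimensional_space X"
  define I where "I = {P. finite P \<and> disjoint P \<and> \<Union>P = topspace X \<and> {} \<notin> P \<and>
    (\<forall>A\<in>P. openin X A \<and> closedin X A)}"
  define leq where "leq = (\<lambda>P Q :: 'a set set. \<forall>B\<in>Q. \<exists>A\<in>P. B \<subseteq> A)"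
  define f where "f = (\<lambda>(P :: 'a set set) (Q :: 'a set set) B. THE A. A \<in> P \<and> B \<subseteq> A)"
  define \<phi> where "\<phi> = (\<lambda>x. \<lambda>P\<in>I. (THE A. A \<in> P \<and> x \<in> A))"
  let ?D = "\<lambda>P :: 'a set set. discrete_topology P"
  let ?L = "inverse_limit I leq ?D f"
  have uniq: "A = A'" if "P \<in> I" "A \<in> P" "A' \<in> P" "x \<in> A" "x \<in> A'" for P A A' x
    using that unfolding I_def by (auto dest: disjointD)
  have f_eq: "f P Q B = A" if "P \<in> I" "A \<in> P" "B \<subseteq> A" "B \<noteq> {}" for P Q A B
    unfolding f_def
  proof (rule the_equality)
    show "A \<in> P \<and> B \<subseteq> A" using that by blast
    show "A' = A" if "A' \<in> P \<and> B \<subseteq> A'" for A'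
      using that \<open>P \<in> I\<close> \<open>A \<in> P\<close> \<open>B \<subseteq> A\<close> \<open>B \<noteq> {}\<close> uniq by blast
  qed
  have phi_eq: "\<phi> x P = A" if "P \<in> I" "A \<in> P" "x \<in> A" for P A x
    unfolding \<phi>_def using that uniq by (auto intro!: the_equality)
  have phi_in: "\<phi> x P \<in> P \<and> x \<in> \<phi> x P" if Px: "P \<in> I" "x \<in> topspace X" for P x
  proof -
    obtain A where "A \<in> P" "x \<in> A" using Px unfolding I_def by blast
    then show ?thesis using phi_eq[OF Px(1)] by metis
  qed
  have nonempty: "B \<noteq> {}" if "P \<in> I" "B \<in> P" for P B
    using that unfolding I_def by blast
  have two: "{A, topspace X - A} - {{}} \<in> I" if "openin X A" "closedin X A" for A
  proof -
    have "A \<subseteq> topspace X" using that openin_subset by blast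
    then show ?thesis unfolding I_def using that
      by (auto simp: disjoint_def closedin_diff openin_diff)
  qed
  have refine: "\<exists>R\<in>I. leq P R \<and> leq Q R" if PQ: "P \<in> I" "Q \<in> I" for P Q
  proof -
    let ?R = "(\<lambda>(A, B). A \<inter> B) ` (P \<times> Q) - {{}}"
    have 1: "finite ?R" using that unfolding I_def by auto
    have 2: "disjoint ?R"
    proof (rule disjointI)
      fix a b assume a: "a \<in> ?R" "b \<in> ?R" "a \<noteq> b"
      then obtain A B A' B' where AB: "a = A \<inter> B" "b = A' \<inter> B'" "A \<in> P" "A' \<in> P" "B \<in> Q" "B' \<in> Q"
        by auto
      show "a \<inter> b = {}"
      proof (rule ccontr)
        assume "a \<inter> b \<noteq> {}"
        then obtain x where "x \<in> a" "x \<in> b" by blast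
        then have "A = A'" "B = B'" using AB uniq that by blast+
        then show False using a AB by blast
      qed
    qed
    have 3: "\<Union>?R = topspace X"
    proof
      show "\<Union>?R \<subseteq> topspace X" using that unfolding I_def by auto
      show "topspace X \<subseteq> \<Union>?R"
      proof
        fix x assume "x \<in> topspace X"
        then obtain A B where AB: "A \<in> P" "B \<in> Q" "x \<in> A" "x \<in> B"
          using phi_in PQ by meson
        then have "A \<inter> B \<in> ?R" by blast
        then show "x \<in> \<Union>?R" using AB by (intro UnionI[of "A \<inter> B"]) auto
      qed
    qed
    have 4: "\<forall>A\<in>?R. openin X A \<and> closedin X A"
    proof
      fix C assume "C \<in> ?R"
      then obtain A B where C: "C = A \<inter> B" "A \<in> P" "B \<in> Q" by auto
      have "openin X A \<and> closedin X A" "openin X B \<and> closedin X B"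
        using C PQ unfolding I_def by blast+
      then show "openin X C \<and> closedin X C"
        unfolding C(1) by (simp add: openin_Int closedin_Int)
    qed
    have RI: "?R \<in> I" unfolding I_def using 1 2 3 4 by blast
    have sub: "\<exists>A\<in>P. \<exists>B\<in>Q. C = A \<inter> B" if "C \<in> ?R" for C
      using that by auto
    have "leq P ?R \<and> leq Q ?R"
      unfolding leq_def
    proof (intro conjI ballI)
      fix C assume "C \<in> ?R"
      from sub[OF this] show "\<exists>A\<in>P. C \<subseteq> A" by blast
    next
      fix C assume "C \<in> ?R"
      from sub[OF this] show "\<exists>B\<in>Q. C \<subseteq> B" by blast
    qed
    then show ?thesis using RI by (rule bexI)
  qed
  have Ine: "I \<noteq> {}"
    using two[of "topspace X"] by auto
  have f_le: "\<exists>A\<in>P. f P Q B = A \<and> B \<subseteq> A" if "P \<in> I" "Q \<in> I" "leq P Q" "B \<in> Q" for P Q B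
  proof -
    have "\<exists>A\<in>P. B \<subseteq> A" using that(3,4) unfolding leq_def by blast
    then obtain A where A: "A \<in> P" "B \<subseteq> A" by blast
    then have "f P Q B = A" using f_eq that(1) nonempty[OF that(2,4)] by blast
    then show ?thesis using A by blast
  qed
  have sys: "inverse_system I leq ?D f"
    unfolding inverse_system_def directed_set_def
  proof (intro conjI ballI impI)
    show "I \<noteq> {}" by (rule Ine)
    show "leq P P" for P unfolding leq_def by blast
    show "leq P R" if "leq P Q" "leq Q R" for P Q R using that unfolding leq_def by (meson order_trans)
    show "\<exists>k\<in>I. leq P k \<and> leq Q k" if "P \<in> I" "Q \<in> I" for P Q using refine that by blast
    show "continuous_map (?D Q) (?D P) (f P Q)" if "P \<in> I" "Q \<in> I" "leq P Q" for P Q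
      using f_le[OF that] by auto
    show "f P P B = B" if "P \<in> I" "B \<in> topspace (?D P)" for P B
      using that f_eq nonempty by auto
    show "f P Q (f Q R B) = f P R B"
      if "P \<in> I" "Q \<in> I" "R \<in> I" "leq P Q" "leq Q R" "B \<in> topspace (?D R)" for P Q R B
    proof -
      have BR: "B \<in> R" using that by simp
      have "\<exists>C\<in>Q. f Q R B = C \<and> B \<subseteq> C" using f_le that BR by blast
      then obtain C where C: "C \<in> Q" "f Q R B = C" "B \<subseteq> C" by blast
      have "\<exists>A\<in>P. f P Q C = A \<and> C \<subseteq> A" using f_le that C by blast
      then obtain A where A: "A \<in> P" "f P Q C = A" "C \<subseteq> A" by blast
      have "f P R B = A"
        using f_eq[OF that(1) A(1)] C(3) A(3) nonempty[OF that(3) BR] by blast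
      then show ?thesis using A(2) C(2) by simp
    qed
  qed
  have Ltop: "topspace ?L = {x \<in> Pi\<^sub>E I (\<lambda>P. P). \<forall>i\<in>I. \<forall>j\<in>I. leq i j \<longrightarrow> f i j (x j) = x i}"
    unfolding inverse_limit_def by auto
  have phi_cont: "continuous_map X (product_topology ?D I) \<phi>"
    unfolding continuous_map_componentwise
  proof (intro conjI ballI)
    show "\<phi> ` topspace X \<subseteq> extensional I" unfolding \<phi>_def by auto
    fix P assume P: "P \<in> I"
    have "{x \<in> topspace X. \<phi> x P \<in> U} = \<Union>U" if "U \<subseteq> P" for U
    proof -
      have "\<Union>U \<subseteq> topspace X" using that P unfolding I_def by blast
      then show ?thesis using phi_in[OF P] phi_eq[OF P] that by fast
    qed
    moreover have "openin X (\<Union>U)" if "U \<subseteq> P" for U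
      using that P unfolding I_def by (intro openin_Union) auto
    ultimately show "continuous_map X (?D P) (\<lambda>x. \<phi> x P)"
      unfolding continuous_map_def using phi_in[OF P] by (auto simp: Pi_iff)
  qed
  have phi_thread: "\<phi> x \<in> topspace ?L" if "x \<in> topspace X" for x
  proof -
    have "\<phi> x \<in> Pi\<^sub>E I (\<lambda>P. P)" using phi_in that unfolding \<phi>_def by auto
    moreover have "f P Q (\<phi> x Q) = \<phi> x P" if PQ: "P \<in> I" "Q \<in> I" "leq P Q" for P Q
    proof -
      have "\<phi> x Q \<in> Q" "x \<in> \<phi> x Q" using phi_in PQ \<open>x \<in> topspace X\<close> by auto
      then obtain A where "A \<in> P" "f P Q (\<phi> x Q) = A" "\<phi> x Q \<subseteq> A"
        using f_le PQ by blast
      then show ?thesis using phi_eq \<open>P \<in> I\<close> \<open>x \<in> \<phi> x Q\<close> by blast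
    qed
    ultimately show ?thesis unfolding Ltop by blast
  qed
  have contL: "continuous_map X ?L \<phi>"
    unfolding inverse_limit_def
    using phi_cont phi_thread Ltop by (auto simp: continuous_map_in_subtopology image_subset_iff)
  have inj: "inj_on \<phi> (topspace X)"
  proof (rule inj_onI, rule ccontr)
    fix x y assume xy: "x \<in> topspace X" "y \<in> topspace X" "\<phi> x = \<phi> y" "x \<noteq> y"
    then obtain U where "openin X U" "x \<in> U" "y \<notin> U"
      using asm unfolding Hausdorff_space_def disjnt_def by (metis disjoint_iff)
    then obtain A where A: "openin X A" "closedin X A" "x \<in> A" "y \<notin> A"
      using asm unfolding zero_dimensional_space_alt by blast
    let ?P = "{A, topspace X - A} - {{}}"
    have P: "?P \<in> I" using two A by blast
    have "\<phi> x ?P = A" using phi_eq[OF P] A by blast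
    moreover have "y \<in> \<phi> y ?P" using phi_in[OF P] xy by blast
    ultimately show False using xy A by auto
  qed
  have surj: "\<phi> ` topspace X = topspace ?L"
  proof
    show "\<phi> ` topspace X \<subseteq> topspace ?L" using phi_thread by blast
    show "topspace ?L \<subseteq> \<phi> ` topspace X"
    proof
      fix t assume t: "t \<in> topspace ?L"
      have tP: "t P \<in> P" if "P \<in> I" for P using t that unfolding Ltop by auto
      have text_t: "t \<in> extensional I" using t unfolding Ltop by (auto simp: PiE_def)
      have step: "\<exists>R\<in>I. t R \<subseteq> \<Inter>(t ` F) \<inter> topspace X" if "finite F" "F \<subseteq> I" for F
        using that
      proof (induction F)
        case empty
        then show ?case using Ine tP unfolding I_def by auto
      next
        case (insert P F)
        then obtain Q where Q: "Q \<in> I" "t Q \<subseteq> \<Inter>(t ` F) \<inter> topspace X" by auto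
        have "P \<in> I" using insert by blast
        then obtain R where R: "R \<in> I" "leq P R" "leq Q R" using refine Q by blast
        have "t R \<subseteq> f P R (t R)" "t R \<subseteq> f Q R (t R)"
          using f_le \<open>P \<in> I\<close> Q R tP by metis+
        moreover have "f P R (t R) = t P" "f Q R (t R) = t Q"
          using t \<open>P \<in> I\<close> Q R unfolding Ltop by auto
        ultimately have "t R \<subseteq> \<Inter>(t ` insert P F) \<inter> topspace X" using Q(2) by auto
        then show ?case using R(1) by blast
      qed
      have "\<Inter>(t ` I) \<noteq> {}"
      proof -
        have "\<forall>C\<in>t ` I. closedin X C" using tP unfolding I_def by blast
        moreover have "\<Inter>\<F> \<noteq> {}" if fF: "finite \<F>" "\<F> \<subseteq> t ` I" for \<F>
        proof -
          obtain F where F: "finite F" "F \<subseteq> I" "\<F> = t ` F"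
            using finite_subset_image[OF fF] by metis
          obtain R where R: "R \<in> I" "t R \<subseteq> \<Inter>(t ` F) \<inter> topspace X"
            using step[OF F(1,2)] by (rule bexE)
          have "t R \<noteq> {}" using nonempty[OF R(1) tP[OF R(1)]] .
          then show ?thesis using R(2) F(3) by auto
        qed
        moreover have "compact_space X" using asm by (rule conjunct1)
        ultimately show ?thesis unfolding compact_space_fip by simp
      qed
      then obtain x where x: "\<And>P. P \<in> I \<Longrightarrow> x \<in> t P" by blast
      obtain P0 where "P0 \<in> I" using Ine by blast
      then have xX: "x \<in> topspace X" using x tP unfolding I_def by blast
      have "\<phi> x P = t P" for P
      proof (cases "P \<in> I")
        case True then show ?thesis using phi_eq x tP by blast
      next
        case False then show ?thesis using text_t by (simp add: \<phi>_def extensional_def)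
      qed
      then show "t \<in> \<phi> ` topspace X" using xX by blast
    qed
  qed
  have "Hausdorff_space ?L"
    unfolding inverse_limit_def
    by (simp add: Hausdorff_space_subtopology Hausdorff_space_product_topology)
  then have "homeomorphic_map X ?L \<phi>"
    using asm contL inj surj continuous_imp_homeomorphic_map by blast
  then have "X homeomorphic_space ?L" using homeomorphic_map_imp_homeomorphic_space by blast
  moreover have "\<forall>P\<in>I. finite P" unfolding I_def by blast
  ultimately show "profinite_space X"
    unfolding profinite_space_def using sys
    by (intro exI[of _ I] exI[of _ leq] exI[of _ "\<lambda>P. P"] exI[of _ f] conjI)
qed

locale topological_group = group G for G (structure) +
  fixes T :: "'a topology"
  assumes topspace_eq: "topspace T = carrier G"
    and continuous_mult: "continuous_map (prod_topology T T) T (\<lambda>(x, y). x \<otimes> y)"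
    and continuous_inv: "continuous_map T T (\<lambda>x. inv x)"

locale profinite_group = topological_group G T for G (structure) and T +
  assumes profinite: "profinite_space T"

section \<open>Partial actions\<close>

text \<open>A partially defined map is given by its domain \<open>D\<close>, which is the set \<open>G*X\<close>, and a function
  \<open>\<eta>\<close> whose values outside of \<open>D\<close> are irrelevant: \<open>(g, x) \<in> D\<close> means that \<open>g \<cdot> x\<close> is defined, and
  then \<open>g \<cdot> x = \<eta> g x\<close>.\<close>

locale partial_action = group G for G (structure) +
  fixes X :: "'x set" and D :: "('a \<times> 'x) set" and \<eta> :: "'a \<Rightarrow> 'x \<Rightarrow> 'x"
  assumes dom_subset: "D \<subseteq> carrier G \<times> X"
    and closed: "(g, x) \<in> D \<Longrightarrow> \<eta> g x \<in> X"
    and PA1: "(g, x) \<in> D \<Longrightarrow> (inv g, \<eta> g x) \<in> D \<and> \<eta> (inv g) (\<eta> g x) = x"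
    and PA2: "(h, x) \<in> D \<Longrightarrow> (g, \<eta> h x) \<in> D \<Longrightarrow>
                (g \<otimes> h, x) \<in> D \<and> \<eta> g (\<eta> h x) = \<eta> (g \<otimes> h) x"
    and PA3: "x \<in> X \<Longrightarrow> (\<one>, x) \<in> D \<and> \<eta> \<one> x = x"

text \<open>The set \<open>X\<^sub>g\<close>.\<close>

definition partial_range :: "('a, 'm) monoid_scheme \<Rightarrow> 'x set \<Rightarrow> ('a \<times> 'x) set \<Rightarrow> 'a \<Rightarrow> 'x set" where
  "partial_range G X D g = {x \<in> X. (inv\<^bsub>G\<^esub> g, x) \<in> D}"

locale topological_partial_action =
  topological_group G T + partial_action G "topspace X" D \<eta>
  for G (structure) and T and X :: "'x topology" and D and \<eta> +
  assumes open_range: "g \<in> carrier G \<Longrightarrow> openin X (partial_range G (topspace X) D g)"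
    and homeomorphism: "g \<in> carrier G \<Longrightarrow>
          homeomorphic_map (subtopology X (partial_range G (topspace X) D (inv g)))
                           (subtopology X (partial_range G (topspace X) D g)) (\<eta> g)"

locale continuous_partial_action = topological_partial_action +
  assumes continuous: "continuous_map (subtopology (prod_topology T X) D) X (\<lambda>(g, x). \<eta> g x)"

definition free_partial_action ::
    "('a, 'm) monoid_scheme \<Rightarrow> ('a \<times> 'x) set \<Rightarrow> ('a \<Rightarrow> 'x \<Rightarrow> 'x) \<Rightarrow> bool" where
  "free_partial_action G D \<eta> \<longleftrightarrow> (\<forall>(g, x) \<in> D. \<eta> g x = x \<longrightarrow> g = \<one>\<^bsub>G\<^esub>)"

section \<open>Orbit space\<close>

definition quotient_topology :: "'a topology \<Rightarrow> ('a \<Rightarrow> 'b) \<Rightarrow> 'b topology" where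
  "quotient_topology X q =
     topology (\<lambda>U. U \<subseteq> q ` topspace X \<and> openin X {x \<in> topspace X. q x \<in> U})"

lemma openin_quotient_topology:
  "openin (quotient_topology X q) U \<longleftrightarrow>
     U \<subseteq> q ` topspace X \<and> openin X {x \<in> topspace X. q x \<in> U}"
proof -
  let ?P = "\<lambda>U. U \<subseteq> q ` topspace X \<and> openin X {x \<in> topspace X. q x \<in> U}"
  have "istopology ?P"
    unfolding istopology_def
  proof (intro conjI allI impI)
    fix S T assume "?P S" "?P T"
    moreover have "{x \<in> topspace X. q x \<in> S \<inter> T} =
        {x \<in> topspace X. q x \<in> S} \<inter> {x \<in> topspace X. q x \<in> T}" by auto
    ultimately show "S \<inter> T \<subseteq> q ` topspace X" "openin X {x \<in> topspace X. q x \<in> S \<inter> T}"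
      by (auto simp only: openin_Int intro: le_infI1)
  next
    fix \<K> assume K: "\<forall>K\<in>\<K>. ?P K"
    then show "\<Union>\<K> \<subseteq> q ` topspace X" by blast
    have "{x \<in> topspace X. q x \<in> \<Union>\<K>} = (\<Union>K\<in>\<K>. {x \<in> topspace X. q x \<in> K})" by auto
    also have "openin X \<dots>" using K by blast
    finally show "openin X {x \<in> topspace X. q x \<in> \<Union>\<K>}" .
  qed
  then show ?thesis by (simp add: quotient_topology_def)
qed

lemma topspace_quotient_topology: "topspace (quotient_topology X q) = q ` topspace X"
proof -
  have "openin (quotient_topology X q) (q ` topspace X)"
  proof -
    have "{x \<in> topspace X. q x \<in> q ` topspace X} = topspace X" by blast
    then show ?thesis unfolding openin_quotient_topology by (metis openin_topspace subset_refl)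
  qed
  then have "q ` topspace X \<subseteq> topspace (quotient_topology X q)" by (rule openin_subset)
  moreover have "topspace (quotient_topology X q) \<subseteq> q ` topspace X"
    using openin_topspace[of "quotient_topology X q"] unfolding openin_quotient_topology by (rule conjunct1)
  ultimately show ?thesis by (rule subset_antisym[rotated])
qed

lemma quotient_map_quotient_topology: "quotient_map X (quotient_topology X q) q"
  by (auto simp: quotient_map_def topspace_quotient_topology openin_quotient_topology)

definition orbit_rel :: "('a, 'm) monoid_scheme \<Rightarrow> 'x set \<Rightarrow> ('a \<times> 'x) set \<Rightarrow> ('a \<Rightarrow> 'x \<Rightarrow> 'x) \<Rightarrow> 'x rel"
  where
  "orbit_rel G X D \<eta> = {(x, y) \<in> X \<times> X. \<exists>g \<in> carrier G. (g, x) \<in> D \<and> \<eta> g x = y}"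

lemma (in partial_action) equiv_orbit_rel: "equiv X (orbit_rel G X D \<eta>)"
proof (rule equivI)
  show "orbit_rel G X D \<eta> \<subseteq> X \<times> X" by (auto simp: orbit_rel_def)
  show "refl_on X (orbit_rel G X D \<eta>)"
    using PA3 by (auto simp: orbit_rel_def refl_on_def)
  show "sym (orbit_rel G X D \<eta>)"
  proof (rule symI)
    fix x y assume "(x, y) \<in> orbit_rel G X D \<eta>"
    then obtain g where "x \<in> X" "y \<in> X" "g \<in> carrier G" "(g, x) \<in> D" "\<eta> g x = y"
      by (auto simp: orbit_rel_def)
    then show "(y, x) \<in> orbit_rel G X D \<eta>"
      using PA1[of g x] by (auto simp: orbit_rel_def intro!: bexI[of _ "inv g"])
  qed
  show "trans (orbit_rel G X D \<eta>)"
  proof (rule transI)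
    fix x y z assume "(x, y) \<in> orbit_rel G X D \<eta>" "(y, z) \<in> orbit_rel G X D \<eta>"
    then obtain g h where "x \<in> X" "z \<in> X" "g \<in> carrier G" "h \<in> carrier G" "(h, x) \<in> D" "\<eta> h x = y"
        "(g, y) \<in> D" "\<eta> g y = z"
      by (auto simp: orbit_rel_def)
    then show "(x, z) \<in> orbit_rel G X D \<eta>"
      using PA2[of h x g] by (auto simp: orbit_rel_def intro!: bexI[of _ "g \<otimes> h"])
  qed
qed

definition orbit_proj ::
    "('a, 'm) monoid_scheme \<Rightarrow> 'x set \<Rightarrow> ('a \<times> 'x) set \<Rightarrow> ('a \<Rightarrow> 'x \<Rightarrow> 'x) \<Rightarrow> 'x \<Rightarrow> 'x set" where
  "orbit_proj G X D \<eta> x = orbit_rel G X D \<eta> `` {x}"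

definition orbit_space ::
    "('a, 'm) monoid_scheme \<Rightarrow> 'x topology \<Rightarrow> ('a \<times> 'x) set \<Rightarrow> ('a \<Rightarrow> 'x \<Rightarrow> 'x) \<Rightarrow> 'x set topology" where
  "orbit_space G X D \<eta> = quotient_topology X (orbit_proj G (topspace X) D \<eta>)"

lemma topspace_orbit_space: "topspace (orbit_space G X D \<eta>) = topspace X // orbit_rel G (topspace X) D \<eta>"
  by (auto simp: orbit_space_def topspace_quotient_topology orbit_proj_def quotient_def)

end

theory Submission
  imports Defs
begin

text \<open>The orbits of a free action are torsors, so the projection to the orbit space behaves like a
  principal \<open>G\<close>-bundle, and the section is obtained by reducing its structure group step by step to
  the trivial group. A reduction to a subgroup \<open>N\<close> (\<open>reduction\<close>) is a closed set \<open>S\<close> that meets every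
  orbit, is invariant under \<open>N\<close>, and in which only elements of \<open>N\<close> move a point of \<open>S\<close> to a point
  of \<open>S\<close>. The whole space is a reduction to \<open>G\<close>; a reduction to \<open>{\<one>}\<close> is a closed set that meets every
  orbit exactly once.

  Two facts drive the argument. By compactness of orbits, the intersection of a chain of reductions
  is again a reduction (\<open>reduction_Inter_chain\<close>), so Zorn's lemma gives a minimal one. And if \<open>V\<close> is a
  clopen subgroup of \<open>G\<close>, then every reduction to \<open>N\<close> contains a reduction to \<open>N \<inter> V\<close>
  (\<open>ex_refinement\<close>): freeness and compactness give a finite cover of \<open>X\<close> by clopen sets so small that
  only elements of \<open>V\<close> move one of their points within the same set, and the \<open>V\<close>-translates of these
  sets are combined greedily, each keeping only the orbits not reached before. Since the clopen
  subgroups of a profinite group separate every element from \<open>\<one>\<close> (\<open>clopen_subgroup_avoiding\<close>), a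
  minimal reduction cannot contain two different points of one orbit.

  A closed set \<open>S\<close> with exactly one point in each orbit gives the section: for closed \<open>C\<close>, the points
  whose representative lies in \<open>C\<close> form the union of the orbits of points of \<open>S \<inter> C\<close>, which is the
  image of a compact set and hence closed.\<close>

section \<open>Open subgroups of profinite groups\<close>

lemma (in topological_group) continuous_map_mult:
  assumes "continuous_map Y T f" "continuous_map Y T g"
  shows "continuous_map Y T (\<lambda>y. f y \<otimes> g y)"
  using continuous_map_compose[OF continuous_map_pairedI[OF assms] continuous_mult]
  by (simp add: o_def)

text \<open>The complement of \<open>E\<close> is the projection of a closed subset of \<open>G \<times> G\<close> along the compact factor
  that \<open>w\<close> runs through; this is why the infinite intersection over \<open>w\<close> is still open.\<close>

lemma (in topological_group) clopen_right_translations_into: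
  assumes comp: "compact_space T" and W: "openin T W" "closedin T W" "W \<noteq> {}"
  defines "E \<equiv> {g \<in> carrier G. \<forall>w\<in>W. w \<otimes> g \<in> W}"
  shows "openin T E \<and> closedin T E"
proof
  have WG: "W \<subseteq> carrier G" using W openin_subset topspace_eq by blast
  let ?B = "{p \<in> topspace (prod_topology T T). fst p \<otimes> snd p \<in> topspace T - W} \<inter> (W \<times> topspace T)"
  have "closedin (prod_topology T T) ?B"
  proof (rule closedin_Int)
    show "closedin (prod_topology T T) {p \<in> topspace (prod_topology T T). fst p \<otimes> snd p \<in> topspace T - W}"
      using W(1) by (intro closedin_continuous_map_preimage[where Y = T] continuous_map_mult
          continuous_map_fst continuous_map_snd) auto
    show "closedin (prod_topology T T) (W \<times> topspace T)"
      using W by (simp add: closedin_prod_Times_iff)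
  qed
  then have "closedin T (snd ` ?B)"
    using closed_map_snd[OF comp] unfolding closed_map_def by blast
  moreover have "E = topspace T - snd ` ?B"
    using WG by (force simp: E_def topspace_eq)
  ultimately show "openin T E" by blast
  have "closedin T {g \<in> topspace T. w \<otimes> g \<in> W}" if "w \<in> W" for w
    using W that WG
    by (intro closedin_continuous_map_preimage[where Y = T] continuous_map_mult) (auto simp: topspace_eq)
  then have "closedin T (\<Inter>w\<in>W. {g \<in> topspace T. w \<otimes> g \<in> W})"
    using W(3) by (intro closedin_Inter) auto
  moreover have "E = (\<Inter>w\<in>W. {g \<in> topspace T. w \<otimes> g \<in> W})"
    using W(3) by (auto simp: E_def topspace_eq)
  ultimately show "closedin T E" by simp
qed

text \<open>A clopen neighbourhood \<open>W\<close> of \<open>\<one>\<close> contains a clopen subgroup, namely its stabiliser under right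
  translation: from \<open>\<one> \<in> W\<close> it follows that every \<open>g\<close> with \<open>W g \<subseteq> W\<close> lies in \<open>W\<close>.\<close>

lemma (in profinite_group) clopen_subgroup_avoiding:
  assumes g: "g \<in> carrier G" "g \<noteq> \<one>"
  shows "\<exists>V. subgroup V G \<and> openin T V \<and> closedin T V \<and> g \<notin> V"
proof -
  have comp: "compact_space T" and haus: "Hausdorff_space T" and zero: "zero_dimensional_space T"
    using profinite profinite_space_iff by blast+
  obtain O1 where O1: "openin T O1" "\<one> \<in> O1" "g \<notin> O1"
    using haus g topspace_eq unfolding Hausdorff_space_def disjnt_def
    by (metis disjoint_iff one_closed)
  then obtain W where W: "openin T W" "closedin T W" "\<one> \<in> W" "W \<subseteq> O1"
    using zero unfolding zero_dimensional_space_alt by meson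
  have WG: "W \<subseteq> carrier G" using W openin_subset topspace_eq by blast
  define E where "E = {g \<in> carrier G. \<forall>w\<in>W. w \<otimes> g \<in> W}"
  define V where "V = {h \<in> E. inv h \<in> E}"
  have E: "openin T E" "closedin T E"
    using clopen_right_translations_into[OF comp W(1,2)] W(3) unfolding E_def by auto
  have V_eq: "V = E \<inter> {h \<in> topspace T. inv h \<in> E}"
    by (auto simp: V_def E_def topspace_eq)
  have "openin T V" "closedin T V"
    unfolding V_eq
    using E openin_continuous_map_preimage[OF continuous_inv]
      closedin_continuous_map_preimage[OF continuous_inv] by blast+
  moreover have "subgroup V G"
  proof (rule subgroupI)
    show "V \<subseteq> carrier G" by (auto simp: V_def E_def)
    have "\<one> \<in> V" using WG by (auto simp: V_def E_def)
    then show "V \<noteq> {}" by blast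
    show "inv a \<in> V" if "a \<in> V" for a using that by (auto simp: V_def E_def)
    show "a \<otimes> b \<in> V" if "a \<in> V" "b \<in> V" for a b
      using that WG by (auto simp: V_def E_def inv_mult_group subset_iff simp flip: m_assoc)
  qed
  moreover have "g \<notin> V"
  proof
    assume "g \<in> V"
    then have "\<one> \<otimes> g \<in> W" using W(3) by (auto simp: V_def E_def)
    then show False using g O1(3) W(4) by auto
  qed
  ultimately show ?thesis by blast
qed

section \<open>Translates under a partial action\<close>

definition (in partial_action) translates :: "'a set \<Rightarrow> 'x set \<Rightarrow> 'x set" where
  "translates V W = (\<lambda>(g, x). \<eta> g x) ` (D \<inter> V \<times> W)"

context partial_action
begin

lemma translatesI: "(g, x) \<in> D \<Longrightarrow> g \<in> V \<Longrightarrow> x \<in> W \<Longrightarrow> \<eta> g x \<in> translates V W"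
  by (force simp: translates_def)

lemma translatesE:
  assumes "y \<in> translates V W"
  obtains g x where "(g, x) \<in> D" "g \<in> V" "x \<in> W" "y = \<eta> g x"
  using assms by (auto simp: translates_def)

definition returns_in :: "'a set \<Rightarrow> 'x set \<Rightarrow> bool" where
  "returns_in V W \<longleftrightarrow> (\<forall>g x. (g, x) \<in> D \<longrightarrow> x \<in> W \<longrightarrow> \<eta> g x \<in> W \<longrightarrow> g \<in> V)"

lemma returns_inD: "returns_in V W \<Longrightarrow> (g, x) \<in> D \<Longrightarrow> x \<in> W \<Longrightarrow> \<eta> g x \<in> W \<Longrightarrow> g \<in> V"
  by (simp add: returns_in_def)

lemma translates_mono: "V \<subseteq> V' \<Longrightarrow> W \<subseteq> W' \<Longrightarrow> translates V W \<subseteq> translates V' W'"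
  by (auto simp: translates_def)

text \<open>For a subgroup \<open>H\<close>, the set \<open>translates H W\<close> is the \<open>H\<close>-saturation of \<open>W\<close>; the next three lemmas
  are the corresponding closure properties. In particular \<open>translates (carrier G) W\<close> is the union of
  the orbits that meet \<open>W\<close>.\<close>

lemma subset_translates:
  assumes "subgroup H G" "W \<subseteq> X"
  shows "W \<subseteq> translates H W"
proof
  fix x assume "x \<in> W"
  then show "x \<in> translates H W"
    using translatesI[of \<one> x H W] PA3[of x] subgroup.one_closed[OF assms(1)] assms(2) by auto
qed

lemma translates_translates:
  assumes "subgroup H G"
  shows "translates H (translates H W) \<subseteq> translates H W"
proof
  fix z assume "z \<in> translates H (translates H W)"
  then obtain g h x where "(h, x) \<in> D" "h \<in> H" "x \<in> W" "(g, \<eta> h x) \<in> D" "g \<in> H" "z = \<eta> g (\<eta> h x)"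
    by (metis translatesE)
  then show "z \<in> translates H W"
    using PA2[of h x g] translatesI[of "g \<otimes> h" x H W] subgroup.m_closed[OF assms] by auto
qed

lemma translates_sym:
  assumes "subgroup H G" "(g, x) \<in> D" "g \<in> H" "\<eta> g x \<in> translates H W"
  shows "x \<in> translates H W"
proof -
  have "(inv g, \<eta> g x) \<in> D" "\<eta> (inv g) (\<eta> g x) = x" using PA1[OF assms(2)] by auto
  moreover have "inv g \<in> H" using assms subgroup.m_inv_closed by metis
  ultimately have "x \<in> translates H (translates H W)" using assms(4) translatesI by metis
  then show ?thesis using translates_translates[OF assms(1)] by blast
qed

end

section \<open>Free partial actions on profinite spaces\<close>

locale free_profinite_partial_action =
  profinite_group G T + continuous_partial_action G T X D \<eta>
  for G (structure) and T and X :: "'x topology" and D and \<eta> +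
  assumes profinite_X: "profinite_space X"
    and free: "free_partial_action G D \<eta>"
    and closed_domain: "closedin (prod_topology T X) D"
begin

lemma compact_X: "compact_space X" and Hausdorff_X: "Hausdorff_space X"
  and zero_dimensional_X: "zero_dimensional_space X"
  using profinite_X profinite_space_iff by blast+

lemma carrier_subgroup: "subgroup (carrier G) G"
  by (rule subgroup_self)

lemma compactin_domain_Times:
  assumes "closedin T V" "closedin X W"
  shows "compactin (subtopology (prod_topology T X) D) (D \<inter> V \<times> W)"
proof -
  have "compact_space T" using profinite profinite_space_iff by blast
  then have "compact_space (prod_topology T X)"
    using compact_X compact_space_prod_topology by blast
  moreover have "closedin (prod_topology T X) (D \<inter> V \<times> W)"
    using closed_domain assms by (simp add: closedin_Int closedin_prod_Times_iff)
  ultimately show ?thesis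
    by (simp add: closedin_compact_space compactin_subtopology)
qed

text \<open>The domain is closed in a compact space, so the translates of a closed set by a closed set are the
  continuous image of a compact set.\<close>

lemma closedin_translates:
  assumes "closedin T V" "closedin X W"
  shows "closedin X (translates V W)"
  unfolding translates_def
  using compactin_domain_Times[OF assms] continuous image_compactin Hausdorff_X
    compactin_imp_closedin by blast

lemma closedin_orbit_of_closed:
  assumes "closedin X W"
  shows "closedin X (translates (carrier G) W)"
  using closedin_translates[OF _ assms] closedin_topspace topspace_eq by metis

text \<open>The pairs \<open>(y, g \<cdot> y)\<close> with \<open>g \<notin> V\<close> form a compact set, which by freeness avoids the diagonal; so
  \<open>(x, x)\<close> has a box neighbourhood disjoint from it.\<close>

lemma ex_small_clopen:
  assumes V: "openin T V" "\<one> \<in> V" and x: "x \<in> topspace X"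
  shows "\<exists>W. openin X W \<and> closedin X W \<and> x \<in> W \<and> returns_in V W"
proof -
  let ?Z = "subtopology (prod_topology T X) D"
  let ?f = "\<lambda>(g, y). (y, \<eta> g y)"
  let ?K = "D \<inter> (topspace T - V) \<times> topspace X"
  have "continuous_map ?Z X snd"
    by (simp add: continuous_map_from_subtopology continuous_map_snd)
  then have "continuous_map ?Z (prod_topology X X) ?f"
    using continuous_map_pairedI[OF _ continuous, of X snd] by (simp add: case_prod_beta')
  moreover have "compactin ?Z ?K"
    using V(1) by (intro compactin_domain_Times) auto
  ultimately have "compactin (prod_topology X X) (?f ` ?K)"
    using image_compactin by blast
  then have "closedin (prod_topology X X) (?f ` ?K)"
    using Hausdorff_X by (simp add: compactin_imp_closedin Hausdorff_space_prod_topology)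
  then have "openin (prod_topology X X) (topspace (prod_topology X X) - ?f ` ?K)"
    by (rule openin_diff[OF openin_topspace])
  moreover have "(x, x) \<notin> ?f ` ?K"
    using free V(2) by (auto simp: free_partial_action_def)
  then have "(x, x) \<in> topspace (prod_topology X X) - ?f ` ?K"
    using x by simp
  ultimately have "\<exists>A B. openin X A \<and> openin X B \<and> x \<in> A \<and> x \<in> B \<and>
      A \<times> B \<subseteq> topspace (prod_topology X X) - ?f ` ?K"
    unfolding openin_prod_topology_alt by presburger
  then obtain A B where AB: "openin X A" "openin X B" "x \<in> A" "x \<in> B"
      "A \<times> B \<subseteq> topspace (prod_topology X X) - ?f ` ?K"
    by (elim exE conjE)
  then have "openin X (A \<inter> B)" "x \<in> A \<inter> B" by auto
  then obtain W where W: "openin X W" "closedin X W" "x \<in> W" "W \<subseteq> A \<inter> B"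
    using zero_dimensional_X unfolding zero_dimensional_space_alt by meson
  have "g \<in> V" if "(g, y) \<in> D" "y \<in> W" "\<eta> g y \<in> W" for g y
  proof (rule ccontr)
    assume "g \<notin> V"
    then have "(g, y) \<in> ?K" using that dom_subset topspace_eq by auto
    then have "(y, \<eta> g y) \<in> ?f ` ?K" by force
    then show False using AB(5) W(4) that by blast
  qed
  then have "returns_in V W" by (simp add: returns_in_def)
  then show ?thesis using W by blast
qed

lemma ex_finite_small_clopen_cover:
  assumes V: "openin T V" "\<one> \<in> V"
  shows "\<exists>\<W>. finite \<W> \<and> \<Union>\<W> = topspace X \<and> (\<forall>W\<in>\<W>. openin X W \<and> closedin X W \<and> returns_in V W)"
proof -
  let ?\<U> = "{W. openin X W \<and> closedin X W \<and> returns_in V W}"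
  have "topspace X \<subseteq> \<Union>?\<U>" using ex_small_clopen[OF V] by blast
  then obtain \<W> where \<W>: "finite \<W>" "\<W> \<subseteq> ?\<U>" "topspace X \<subseteq> \<Union>\<W>"
    using compact_X unfolding compact_space_alt
    by (metis (no_types, lifting) mem_Collect_eq)
  then have "\<Union>\<W> = topspace X" using openin_subset by blast
  then show ?thesis using \<W> by blast
qed

section \<open>Reductions to subgroups\<close>

text \<open>If the action is global, the last three conditions say that \<open>S\<close> meets each orbit in a single
  \<open>N\<close>-orbit, which is a reduction of the structure group in the sense of principal bundles.\<close>

definition reduction :: "'a set \<Rightarrow> 'x set \<Rightarrow> bool" where
  "reduction N S \<longleftrightarrow> subgroup N G \<and> closedin X S \<and>
     topspace X \<subseteq> translates (carrier G) S \<and>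
     translates N S \<subseteq> S \<and> returns_in N S"

lemma reductionD:
  assumes "reduction N S"
  shows "subgroup N G" "closedin X S" "topspace X \<subseteq> translates (carrier G) S"
    "translates N S \<subseteq> S" "returns_in N S"
  using assms by (auto simp: reduction_def)

lemma reduction_whole: "reduction (carrier G) (topspace X)"
  unfolding reduction_def returns_in_def
  using carrier_subgroup subset_translates[OF carrier_subgroup] dom_subset closed
  by (auto elim!: translatesE)

text \<open>Openness is where the invariance of \<open>S\<close> enters. If \<open>y = g \<cdot> w\<close> with \<open>w \<in> W\<close>, then \<open>g \<in> N\<close>; for \<open>z \<in> S\<close>
  near \<open>y\<close>, the point \<open>g\<^sup>-\<^sup>1 \<cdot> z\<close> is defined, is near \<open>w\<close>, and stays in \<open>S\<close> by invariance, hence in \<open>W\<close>,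
  as \<open>W\<close> is open relative to \<open>S\<close>. Thus saturations of relatively clopen sets are relatively clopen, which allows
  complements of saturations to be used in refining \<open>S\<close>.\<close>

lemma clopen_translates_in_reduction:
  assumes red: "reduction N S" and V: "closedin T V"
    and W: "openin (subtopology X S) W" "closedin (subtopology X S) W"
  shows "openin (subtopology X S) (S \<inter> translates V W) \<and>
    closedin (subtopology X S) (S \<inter> translates V W)"
proof
  note S = reductionD[OF red]
  have "closedin X W" using W(2) S(2) closedin_closed_subtopology by blast
  then show "closedin (subtopology X S) (S \<inter> translates V W)"
    using closedin_translates[OF V] by (metis closedin_subtopology inf_commute)
  obtain W' where W': "openin X W'" "W = W' \<inter> S"
    using W(1) unfolding openin_subtopology by blast
  show "openin (subtopology X S) (S \<inter> translates V W)"
  proof (subst openin_subopen, intro ballI)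
    fix y assume y: "y \<in> S \<inter> translates V W"
    then obtain g w where gw: "(g, w) \<in> D" "g \<in> V" "w \<in> W" "y = \<eta> g w"
      by (auto elim: translatesE)
    have gN: "g \<in> N"
      using returns_inD[OF S(5) gw(1)] gw(3,4) y W'(2) by blast
    have gG: "g \<in> carrier G" using gw dom_subset by blast
    let ?R = "partial_range G (topspace X) D"
    have cont: "continuous_map (subtopology X (?R g)) X (\<eta> (inv g))"
      using homeomorphic_imp_continuous_map[OF homeomorphism[of "inv g"]] gG
      by (simp add: continuous_map_in_subtopology)
    let ?A = "{z \<in> topspace (subtopology X (?R g)). \<eta> (inv g) z \<in> W'}"
    have "openin (subtopology X (?R g)) ?A"
      using openin_continuous_map_preimage[OF cont W'(1)] .
    then have "openin X ?A"
      using open_range[OF gG] openin_open_subtopology by blast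
    then have "openin (subtopology X S) (S \<inter> ?A)"
      by (metis openin_subtopology inf_commute)
    moreover have "y \<in> S \<inter> ?A"
      using y gw PA1[OF gw(1)] W'(2) closed[OF gw(1)] by (auto simp: partial_range_def)
    moreover have "S \<inter> ?A \<subseteq> S \<inter> translates V W"
    proof
      fix z assume z: "z \<in> S \<inter> ?A"
      then have zD: "(inv g, z) \<in> D" "\<eta> (inv g) z \<in> W'" "z \<in> S" by (auto simp: partial_range_def)
      have "inv g \<in> N" using S(1) gN subgroup.m_inv_closed by metis
      then have "\<eta> (inv g) z \<in> translates N S" using zD translatesI by blast
      then have "\<eta> (inv g) z \<in> W" using S(4) zD W'(2) by blast
      moreover have "(g, \<eta> (inv g) z) \<in> D" "\<eta> g (\<eta> (inv g) z) = z"
        using PA1[OF zD(1)] gG by auto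
      ultimately show "z \<in> S \<inter> translates V W" using zD gw(2) translatesI by (metis IntI)
    qed
    ultimately show "\<exists>U. openin (subtopology X S) U \<and> y \<in> U \<and> U \<subseteq> S \<inter> translates V W" by blast
  qed
qed

text \<open>The greedy construction. Given \<open>P\<close> for the sets treated so far, the next set \<open>W\<close> contributes the
  \<open>V\<close>-saturation of \<open>S \<inter> W\<close> without the orbits that meet \<open>P\<close>. Saturating first gives invariance and
  does no harm to smallness: if \<open>u \<cdot> w\<close> is moved to \<open>u' \<cdot> w'\<close> by \<open>g\<close>, then \<open>u'\<^sup>-\<^sup>1 g u\<close> moves \<open>w\<close> to \<open>w'\<close>
  inside \<open>W\<close>, so that \<open>g \<in> V\<close>. Points of \<open>P\<close> and points of the new part lie in different orbits.\<close>

lemma ex_partial_refinement: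
  assumes red: "reduction N S"
    and V: "subgroup V G" "closedin T V"
    and \<W>: "finite \<W>" "\<forall>W\<in>\<W>. openin X W \<and> closedin X W \<and> returns_in V W"
  shows "\<exists>S'. openin (subtopology X S) S' \<and> closedin (subtopology X S) S' \<and>
    S \<inter> \<Union>\<W> \<subseteq> translates (carrier G) S' \<and> translates (N \<inter> V) S' \<subseteq> S' \<and>
    returns_in V S'"
  using \<W>
proof (induction \<W>)
  case empty
  have "translates (N \<inter> V) {} = {}" by (simp add: translates_def)
  moreover have "returns_in V {}" by (simp add: returns_in_def)
  ultimately show ?case by (intro exI[of _ "{}"]) auto
next
  case (insert W \<W>)
  then obtain P where P: "openin (subtopology X S) P" "closedin (subtopology X S) P"
    "S \<inter> \<Union>\<W> \<subseteq> translates (carrier G) P" "translates (N \<inter> V) P \<subseteq> P" "returns_in V P"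
    by auto
  have W: "openin X W" "closedin X W" "returns_in V W"
    using insert.prems by auto
  have S: "S \<subseteq> topspace X" "translates N S \<subseteq> S"
    using reductionD(4)[OF red] closedin_subset[OF reductionD(2)[OF red]] by auto
  have VG: "V \<subseteq> carrier G" using V(1) subgroup.subset by blast
  let ?O = "translates (carrier G)"
  let ?Q = "S \<inter> translates V (S \<inter> W) - S \<inter> ?O P"
  let ?S' = "P \<union> ?Q"
  have PS: "P \<subseteq> S" using P(1) openin_imp_subset by blast
  have SW: "openin (subtopology X S) (S \<inter> W)" "closedin (subtopology X S) (S \<inter> W)"
    using W by (metis openin_subtopology inf_commute, metis closedin_subtopology inf_commute)
  have cG: "closedin T (carrier G)" by (metis closedin_topspace topspace_eq)
  note cl = clopen_translates_in_reduction[OF red V(2) SW]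
    clopen_translates_in_reduction[OF red cG P(1,2)]
  have clopen: "openin (subtopology X S) ?S'" "closedin (subtopology X S) ?S'"
    using cl P(1,2) by (blast intro: openin_Un openin_diff, blast intro: closedin_Un closedin_diff)
  have meets: "S \<inter> \<Union>(insert W \<W>) \<subseteq> ?O ?S'"
  proof
    fix x assume x: "x \<in> S \<inter> \<Union>(insert W \<W>)"
    show "x \<in> ?O ?S'"
    proof (cases "x \<in> ?O P")
      case True
      then show ?thesis using translates_mono[of "carrier G" "carrier G" P ?S'] by blast
    next
      case False
      then have "x \<in> S \<inter> W" using x P(3) by blast
      then have "x \<in> ?S'"
        using False subset_translates[OF V(1), of "S \<inter> W"] S(1) by blast
      then show ?thesis
        using subset_translates[OF carrier_subgroup, of ?S'] PS S(1) by blast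
    qed
  qed
  have invariant: "translates (N \<inter> V) ?S' \<subseteq> ?S'"
  proof
    fix y assume "y \<in> translates (N \<inter> V) ?S'"
    then obtain g x where gx: "(g, x) \<in> D" "g \<in> N" "g \<in> V" "x \<in> ?S'" "y = \<eta> g x"
      by (metis translatesE IntD1 IntD2)
    show "y \<in> ?S'"
    proof (cases "x \<in> P")
      case True
      then show ?thesis using gx P(4) translatesI[of g x "N \<inter> V" P] by blast
    next
      case False
      then have x: "x \<in> S" "x \<in> translates V (S \<inter> W)" "x \<notin> ?O P" using gx(4) by auto
      have "y \<in> S" using S(2) gx x(1) translatesI[of g x N S] by blast
      moreover have "y \<in> translates V (S \<inter> W)"
        using translatesI[OF gx(1,3) x(2)] translates_translates[OF V(1)] gx(5) by blast
      moreover have "y \<notin> ?O P"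
        using translates_sym[OF carrier_subgroup gx(1)] gx(3,5) VG x(3) by blast
      ultimately show ?thesis by blast
    qed
  qed
  have "g \<in> V" if gx: "(g, x) \<in> D" "x \<in> ?S'" "\<eta> g x \<in> ?S'" for g x
  proof -
    have gG: "g \<in> carrier G" using gx dom_subset by blast
    consider "x \<in> P" "\<eta> g x \<in> P" | "x \<in> P" "\<eta> g x \<in> ?Q" | "x \<in> ?Q" "\<eta> g x \<in> P"
      | "x \<in> ?Q" "\<eta> g x \<in> ?Q" using gx by blast
    then show ?thesis
    proof cases
      case 1
      then show ?thesis using returns_inD[OF P(5) gx(1)] by blast
    next
      case 2
      then show ?thesis using translatesI[OF gx(1) gG, of P] by blast
    next
      case 3
      then have "\<eta> g x \<in> ?O P"
        using subset_translates[OF carrier_subgroup, of P] PS S(1) by blast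
      then show ?thesis using 3 translates_sym[OF carrier_subgroup gx(1) gG] by blast
    next
      case 4
      then obtain u w u' w' where u: "(u, w) \<in> D" "u \<in> V" "w \<in> W" "x = \<eta> u w"
        and u': "(u', w') \<in> D" "u' \<in> V" "w' \<in> W" "\<eta> g x = \<eta> u' w'"
        by (auto elim!: translatesE)
      have 1: "(g \<otimes> u, w) \<in> D" "\<eta> (g \<otimes> u) w = \<eta> u' w'"
        using PA2[OF u(1), of g] gx(1) u(4) u'(4) by auto
      have 2: "(inv u' \<otimes> (g \<otimes> u), w) \<in> D" "\<eta> (inv u' \<otimes> (g \<otimes> u)) w = w'"
        using PA2[OF 1(1), of "inv u'"] PA1[OF u'(1)] 1(2) by auto
      have "inv u' \<otimes> (g \<otimes> u) \<in> V" using returns_inD[OF W(3) 2(1) u(3)] 2(2) u'(3) by simp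
      then have "u' \<otimes> (inv u' \<otimes> (g \<otimes> u)) \<otimes> inv u \<in> V"
        using u(2) u'(2) V(1) by (simp add: subgroup.m_closed subgroup.m_inv_closed)
      moreover have "u' \<otimes> (inv u' \<otimes> (g \<otimes> u)) \<otimes> inv u = g"
        using u(2) u'(2) VG gG by (simp add: subset_iff m_assoc flip: m_assoc[of u' "inv u'"])
      ultimately show ?thesis by simp
    qed
  qed
  then have "returns_in V ?S'" unfolding returns_in_def by (intro allI impI)
  with clopen meets invariant show ?case by (intro exI[of _ ?S'] conjI)
qed

lemma ex_refinement:
  assumes red: "reduction N S" and V: "subgroup V G" "openin T V" "closedin T V"
  shows "\<exists>S'\<subseteq>S. reduction (N \<inter> V) S'"
proof -
  have one: "\<one> \<in> V" using V(1) subgroup.one_closed by blast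
  obtain \<W> where \<W>: "finite \<W>" "\<Union>\<W> = topspace X"
    "\<forall>W\<in>\<W>. openin X W \<and> closedin X W \<and> returns_in V W"
    using ex_finite_small_clopen_cover[OF V(2) one] by (elim exE conjE)
  obtain S' where S': "closedin (subtopology X S) S'"
    "S \<inter> \<Union>\<W> \<subseteq> translates (carrier G) S'" "translates (N \<inter> V) S' \<subseteq> S'" "returns_in V S'"
    using ex_partial_refinement[OF red V(1,3) \<W>(1,3)] by (elim exE conjE)
  note S = reductionD[OF red]
  have S'S: "closedin X S'" "S' \<subseteq> S"
    using S'(1) S(2) closedin_closed_subtopology by blast+
  have "S \<subseteq> translates (carrier G) S'"
    using S'(2) \<W>(2) closedin_subset[OF S(2)] by blast
  then have "translates (carrier G) S \<subseteq> translates (carrier G) S'"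
    using translates_mono[of "carrier G" "carrier G"] translates_translates[OF carrier_subgroup] by blast
  then have "topspace X \<subseteq> translates (carrier G) S'" using S(3) by blast
  moreover have "subgroup (N \<inter> V) G" using S(1) V(1) by (rule subgroups_Inter_pair)
  moreover have "returns_in (N \<inter> V) S'"
    using S(5) S'(4) S'S(2) unfolding returns_in_def by blast
  ultimately have "reduction (N \<inter> V) S'" using S'(3) S'S(1) by (simp add: reduction_def)
  then show ?thesis using S'S(2) by (intro exI[of _ S'] conjI)
qed

text \<open>Every orbit is closed and meets each member of the chain, so by compactness it meets the
  intersection. The remaining conditions pass to intersections of arbitrary families, so the subgroups
  \<open>N S\<close> can be chosen independently of each other; this makes it possible to apply Zorn's lemma to the
  sets \<open>S\<close> alone.\<close>

lemma reduction_Inter_chain: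
  assumes ne: "\<C> \<noteq> {}" and chain: "\<And>A B. A \<in> \<C> \<Longrightarrow> B \<in> \<C> \<Longrightarrow> A \<subseteq> B \<or> B \<subseteq> A"
    and red: "\<And>S. S \<in> \<C> \<Longrightarrow> reduction (N S) S"
  shows "reduction (\<Inter>S\<in>\<C>. N S) (\<Inter>\<C>)"
proof -
  have closed_Inter: "closedin X (\<Inter>\<C>)"
    using ne reductionD(2)[OF red] by (intro closedin_Inter) auto
  have "subgroup (\<Inter>S\<in>\<C>. N S) G"
    using ne reductionD(1)[OF red] by (intro subgroups_Inter) auto
  moreover have "translates (\<Inter>S\<in>\<C>. N S) (\<Inter>\<C>) \<subseteq> \<Inter>\<C>"
  proof (rule Inter_greatest)
    fix S assume S: "S \<in> \<C>"
    then have "translates (\<Inter>S\<in>\<C>. N S) (\<Inter>\<C>) \<subseteq> translates (N S) S"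
      by (intro translates_mono) auto
    then show "translates (\<Inter>S\<in>\<C>. N S) (\<Inter>\<C>) \<subseteq> S"
      using reductionD(4)[OF red[OF S]] by blast
  qed
  moreover have "returns_in (\<Inter>S\<in>\<C>. N S) (\<Inter>\<C>)"
    using reductionD(5)[OF red] unfolding returns_in_def by blast
  moreover have "topspace X \<subseteq> translates (carrier G) (\<Inter>\<C>)"
  proof
    fix x assume x: "x \<in> topspace X"
    let ?O = "translates (carrier G) {x}"
    have meets: "?O \<inter> S \<noteq> {}" if SC: "S \<in> \<C>" for S
    proof -
      obtain g y where gy: "(g, y) \<in> D" "g \<in> carrier G" "y \<in> S" "x = \<eta> g y"
        using reductionD(3)[OF red[OF SC]] x by (blast elim: translatesE)
      have "x \<in> ?O" using subset_translates[OF carrier_subgroup, of "{x}"] x by auto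
      then have "y \<in> ?O" using translates_sym[OF carrier_subgroup gy(1,2)] gy(4) by blast
      then show ?thesis using gy(3) by blast
    qed
    have "closedin X ?O"
      using closedin_orbit_of_closed closedin_Hausdorff_singleton[OF Hausdorff_X x] .
    then have closed: "\<forall>C\<in>insert ?O \<C>. closedin X C"
      using reductionD(2)[OF red] by blast
    have "\<Inter>\<F> \<noteq> {}" if \<F>: "finite \<F>" "\<F> \<subseteq> insert ?O \<C>" for \<F>
    proof -
      obtain S where S: "S \<in> \<C>" "S \<subseteq> \<Inter>(\<F> - {?O})"
      proof (cases "\<F> - {?O} = {}")
        case True
        then show ?thesis using that ne by (metis Inter_empty ex_in_conv top_greatest)
      next
        case False
        have "subset.chain \<C> (\<F> - {?O})"
          using \<F>(2) chain by (auto simp: subset_chain_def)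
        then have "\<Inter>(\<F> - {?O}) \<in> \<F> - {?O}"
          using Inter_in_chain[OF finite_Diff[OF \<F>(1)] False] by simp
        then have "\<Inter>(\<F> - {?O}) \<in> \<C>" using \<F>(2) by auto
        then show ?thesis by (rule that) (rule order_refl)
      qed
      have "?O \<inter> S \<subseteq> \<Inter>\<F>" using S(2) by blast
      then show ?thesis using meets[OF S(1)] by blast
    qed
    then have "\<Inter>(insert ?O \<C>) \<noteq> {}"
      using compact_X[unfolded compact_space_fip, rule_format, of "insert ?O \<C>"] closed by simp
    then obtain y where y: "y \<in> ?O" "y \<in> \<Inter>\<C>" by blast
    obtain g x' where gx: "(g, x') \<in> D" "g \<in> carrier G" "x' \<in> {x}" "y = \<eta> g x'"
      using y(1) by (rule translatesE)
    have "\<Inter>\<C> \<subseteq> topspace X"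
      using closedin_subset[OF closed_Inter] .
    then have "\<eta> g x' \<in> translates (carrier G) (\<Inter>\<C>)"
      using y(2) gx(4) subset_translates[OF carrier_subgroup, of "\<Inter>\<C>"] by auto
    then show "x \<in> translates (carrier G) (\<Inter>\<C>)"
      using translates_sym[OF carrier_subgroup gx(1,2)] gx(3) by simp
  qed
  ultimately show ?thesis using closed_Inter by (simp add: reduction_def)
qed

lemma ex_minimal_reduction:
  "\<exists>N S. reduction N S \<and> (\<forall>N' S'. reduction N' S' \<longrightarrow> S' \<subseteq> S \<longrightarrow> S' = S)"
proof -
  \<comment> \<open>reverse inclusion, so that the maximal element of Zorn's lemma is a minimal set\<close>
  let ?A = "{S. \<exists>N. reduction N S}" and ?P = "\<lambda>A B :: 'x set. B \<subseteq> A"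
  have "\<exists>S\<in>?A. \<forall>S'\<in>?A. S' \<subseteq> S \<longrightarrow> S' = S"
  proof (rule predicate_Zorn[where P = ?P])
    show "partial_order_on ?A (relation_of ?P ?A)"
      by (rule partial_order_on_relation_ofI) auto
    fix \<C> assume C: "\<C> \<in> Chains (relation_of ?P ?A)"
    show "\<exists>u\<in>?A. \<forall>S\<in>\<C>. u \<subseteq> S"
    proof (cases "\<C> = {}")
      case True
      then show ?thesis using reduction_whole by blast
    next
      case False
      have "\<forall>S\<in>\<C>. \<exists>N. reduction N S" using Chains_relation_of[OF C] by blast
      then obtain N where N: "\<And>S. S \<in> \<C> \<Longrightarrow> reduction (N S) S" by metis
      have "\<And>A B. A \<in> \<C> \<Longrightarrow> B \<in> \<C> \<Longrightarrow> A \<subseteq> B \<or> B \<subseteq> A"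
        using C unfolding Chains_def relation_of_def by blast
      then have "reduction (\<Inter>S\<in>\<C>. N S) (\<Inter>\<C>)"
        using reduction_Inter_chain[OF False _ N] by blast
      then show ?thesis by (intro bexI[of _ "\<Inter>\<C>"]) auto
    qed
  qed
  then obtain S N where "reduction N S" and "\<forall>S'\<in>?A. S' \<subseteq> S \<longrightarrow> S' = S" by auto
  then show ?thesis by (intro exI[of _ N] exI[of _ S]) auto
qed

text \<open>If \<open>g \<noteq> \<one>\<close> moved a point of a minimal reduction \<open>S\<close> to a point of \<open>S\<close>, then refining \<open>S\<close> by a clopen
  subgroup that avoids \<open>g\<close> would leave one of the two points out.\<close>

lemma ex_reduction_to_trivial_subgroup: "\<exists>S. reduction {\<one>} S"
proof -
  obtain N S where red: "reduction N S"
    and minimal: "\<And>N' S'. reduction N' S' \<Longrightarrow> S' \<subseteq> S \<Longrightarrow> S' = S"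
    using ex_minimal_reduction by metis
  note S = reductionD[OF red]
  have ST: "S \<subseteq> topspace X" using closedin_subset[OF S(2)] .
  have "g = \<one>" if gx: "(g, x) \<in> D" "x \<in> S" "\<eta> g x \<in> S" for g x
  proof (rule ccontr)
    assume "g \<noteq> \<one>"
    moreover have "g \<in> carrier G" using gx(1) dom_subset by auto
    ultimately obtain V where V: "subgroup V G" "openin T V" "closedin T V" "g \<notin> V"
      using clopen_subgroup_avoiding by blast
    then obtain S' where S': "S' \<subseteq> S" "reduction (N \<inter> V) S'"
      using ex_refinement[OF red] by blast
    then have "reduction (N \<inter> V) S" using minimal[OF S'(2,1)] by simp
    then have "g \<in> V" using returns_inD[OF reductionD(5) gx] by blast
    then show False using V(4) by blast
  qed
  then have "returns_in {\<one>} S" by (simp add: returns_in_def)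
  moreover have "translates {\<one>} S \<subseteq> S"
    using PA3 ST by (auto elim!: translatesE)
  ultimately have "reduction {\<one>} S"
    using S(2,3) triv_subgroup by (simp add: reduction_def)
  then show ?thesis by blast
qed

section \<open>The continuous section\<close>

lemma ex_continuous_section:
  "\<exists>s. continuous_map (orbit_space G X D \<eta>) X s \<and>
    (\<forall>c \<in> topspace (orbit_space G X D \<eta>). orbit_proj G (topspace X) D \<eta> (s c) = c)"
proof -
  let ?R = "orbit_rel G (topspace X) D \<eta>" and ?\<pi> = "orbit_proj G (topspace X) D \<eta>"
  note equiv = equiv_orbit_rel
  obtain S where red: "reduction {\<one>} S" using ex_reduction_to_trivial_subgroup by blast
  note S = reductionD(2,3)[OF red]
  have ST: "S \<subseteq> topspace X" using S(1) closedin_subset by blast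
  have unique: "\<eta> g x = x" if "(g, x) \<in> D" "x \<in> S" "\<eta> g x \<in> S" for g x
    using returns_inD[OF reductionD(5)[OF red] that] PA3 that(2) ST by auto
  have rel_iff: "(x, y) \<in> ?R \<longleftrightarrow> (\<exists>g. (g, x) \<in> D \<and> \<eta> g x = y)" for x y
    using dom_subset closed unfolding orbit_rel_def by auto
  have "\<exists>y\<in>S. ?\<pi> y = ?\<pi> x" if x: "x \<in> topspace X" for x
  proof -
    obtain g y where "(g, y) \<in> D" "y \<in> S" "x = \<eta> g y"
      using S(2) x by (blast elim: translatesE)
    then have "(y, x) \<in> ?R" using rel_iff by blast
    then show ?thesis
      using \<open>y \<in> S\<close> equiv_class_eq[OF equiv] unfolding orbit_proj_def by blast
  qed
  then have "\<forall>c\<in>?\<pi> ` topspace X. \<exists>y\<in>S. ?\<pi> y = c" by auto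
  then obtain s where s: "\<And>c. c \<in> ?\<pi> ` topspace X \<Longrightarrow> s c \<in> S \<and> ?\<pi> (s c) = c"
    by metis
  \<comment> \<open>the representative of an orbit is its only point in \<open>S\<close>, so it can be recognised by membership in \<open>S\<close>\<close>
  have s_eq: "s (?\<pi> x) = y" if "(g, y) \<in> D" "y \<in> S" "x = \<eta> g y" for g x y
  proof -
    have xy: "(y, x) \<in> ?R" using that rel_iff by blast
    then have x: "x \<in> topspace X" by (auto simp: orbit_rel_def)
    have "?\<pi> y = ?\<pi> (s (?\<pi> x))"
      using s[of "?\<pi> x"] x equiv_class_eq[OF equiv xy] unfolding orbit_proj_def by auto
    then have "(y, s (?\<pi> x)) \<in> ?R"
      using eq_equiv_class[OF _ equiv] s[of "?\<pi> x"] x ST unfolding orbit_proj_def by blast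
    then obtain h where "(h, y) \<in> D" "\<eta> h y = s (?\<pi> x)" using rel_iff by blast
    then show ?thesis using unique[of h y] that(2) s[of "?\<pi> x"] x by simp
  qed
  have "continuous_map X X (s \<circ> ?\<pi>)"
    unfolding continuous_map_closedin
  proof (intro conjI ballI allI impI)
    show "s \<circ> ?\<pi> \<in> topspace X \<rightarrow> topspace X"
      using s ST by auto
    fix C assume C: "closedin X C"
    have "{x \<in> topspace X. (s \<circ> ?\<pi>) x \<in> C} = translates (carrier G) (S \<inter> C)"
    proof (intro equalityI subsetI)
      fix x assume x: "x \<in> {x \<in> topspace X. (s \<circ> ?\<pi>) x \<in> C}"
      then obtain g y where gy: "(g, y) \<in> D" "g \<in> carrier G" "y \<in> S" "x = \<eta> g y"
        using S(2) by (blast elim: translatesE)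
      then have "y \<in> C" using s_eq x by auto
      then show "x \<in> translates (carrier G) (S \<inter> C)" using gy translatesI by blast
    next
      fix x assume "x \<in> translates (carrier G) (S \<inter> C)"
      then obtain g y where "(g, y) \<in> D" "y \<in> S" "y \<in> C" "x = \<eta> g y"
        by (auto elim: translatesE)
      then show "x \<in> {x \<in> topspace X. (s \<circ> ?\<pi>) x \<in> C}" using s_eq closed by auto
    qed
    then show "closedin X {x \<in> topspace X. (s \<circ> ?\<pi>) x \<in> C}"
      using closedin_orbit_of_closed[of "S \<inter> C"] S(1) C by auto
  qed
  then have "continuous_map (orbit_space G X D \<eta>) X s"
    unfolding orbit_space_def
    using continuous_compose_quotient_map quotient_map_quotient_topology by blast
  then show ?thesis
    using s by (auto simp: orbit_space_def topspace_quotient_topology)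
qed

end

theorem theorem3p7:
  fixes G :: "('g, 'm) monoid_scheme"
    and T :: "'g topology"
    and X :: "'x topology"
    and D :: "('g \<times> 'x) set"
    and \<eta> :: "'g \<Rightarrow> 'x \<Rightarrow> 'x"
  assumes "profinite_group G T"
    and "profinite_space X"
    and "continuous_partial_action G T X D \<eta>"
    and "free_partial_action G D \<eta>"
    and "openin (prod_topology T X) D" and "closedin (prod_topology T X) D"
  shows "\<exists>s. continuous_map (orbit_space G X D \<eta>) X s \<and>
             (\<forall>c \<in> topspace (orbit_space G X D \<eta>). orbit_proj G (topspace X) D \<eta> (s c) = c)"
proof -
  interpret free_profinite_partial_action G T X D \<eta>
    using assms unfolding free_profinite_partial_action_def free_profinite_partial_action_axioms_def
    by blast
  show ?thesis by (rule ex_continuous_section)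
qed

end
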